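(* For six unit vectors $\mathcal D=\{d_1,\ldots,d_6\}\subset\mathbb S^2\subset\mathbb R^3$ set $$\alpha_{\mathcal D}=\inf_{\substack{B\in\operatorname{Sym}(3)\\ \|B\|_{\mathrm F}=1}}\ \sum_{j=1}^6(d_j^\top Bd_j)^2.$$ Then every such system satisfies $\alpha_{\mathcal D}\le\frac45$. Equality holds if and only if $$\sum_{j=1}^6d_j\otimes d_j=2\,\mathrm{Id}\qquad\text{and}\qquad |d_i\cdot d_j|^2=\frac15\quad(i\ne j).$$ In the equality case, for every $B\in\operatorname{Sym}(3)$, writing $B=B_0+\frac{\operatorname{tr}B}{3}\mathrm{Id}$ with $\operatorname{tr}B_0=0$, one has $$\sum_{j=1}^6(d_j^\top Bd_j)^2=\frac45\|B_0\|_{\mathrm F}^2+\frac23(\operatorname{tr}B)^2.$$ Finally, choosing one unit vector on each of the six axes through opposite vertices of a regular icosahedron centered at the origin gives a system attaining equality.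
   Context: $\operatorname{Sym}(3)$ is the space of real symmetric $3\times3$ matrices, $\|\cdot\|_{\mathrm F}$ is the Frobenius norm, and $d\otimes d=dd^\top$. *)

theory Defs
  imports "HOL-Analysis.Analysis"
begin

definition Sym3 :: "(real^3^3) set"
  where "Sym3 = {B. transpose B = B}"

definition outer_square :: "real^'n \<Rightarrow> real^'n^'n"
  where "outer_square u = (columnvector u :: real^1^'n) ** (rowvector u :: real^'n^1)"

definition quartic_sum :: "(6 \<Rightarrow> real^3) \<Rightarrow> real^3^3 \<Rightarrow> real"
  where "quartic_sum d B = (\<Sum>j\<in>UNIV. (d j \<bullet> (B *v d j))\<^sup>2)"

text \<open>The library norm on \<^typ>\<open>real^3^3\<close> is the Euclidean norm of the
  rows' Euclidean norms, i.e. the Frobenius norm (not the operator norm).\<close>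

definition alpha :: "(6 \<Rightarrow> real^3) \<Rightarrow> real"
  where "alpha d = (INF B\<in>{B \<in> Sym3. norm B = 1}. quartic_sum d B)"

definition golden :: real
  where "golden = (1 + sqrt 5) / 2"

definition std_icosahedron_vertices :: "(real^3) set"
  where "std_icosahedron_vertices =
    (\<Union>s\<in>{1, -1}. \<Union>t\<in>{1, -1}.
      {vector [0, s, t * golden], vector [s, t * golden, 0], vector [t * golden, 0, s]})"

text \<open>A regular icosahedron is a solid similar to the one with the classical vertices
  \<open>(0, \<plusminus>1, \<plusminus>\<phi>)\<close> and their cyclic permutations, where \<open>\<phi>\<close> is the golden ratio; that
  model has its centre at the origin, so \<open>c\<close> is the centre of the copy. Any radius and any
  orientation (orthogonal map) is allowed.\<close>

definition regular_icosahedron :: "real^3 \<Rightarrow> (real^3) set \<Rightarrow> bool"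
  where "regular_icosahedron c P \<longleftrightarrow>
    (\<exists>r f. r > 0 \<and> orthogonal_transformation f \<and>
      P = (\<lambda>x. c + r *\<^sub>R f x) ` (convex hull std_icosahedron_vertices))"

text \<open>The lines joining opposite vertices of a polytope centred at the origin.\<close>

definition vertex_axes :: "(real^3) set \<Rightarrow> (real^3) set set"
  where "vertex_axes P =
    {affine hull {v, - v} | v. v extreme_point_of P \<and> (- v) extreme_point_of P}"

end

theory Submission
  imports Defs
begin

text \<open>
  Write \<open>P\<^sub>j = d\<^sub>j \<otimes> d\<^sub>j\<close>, so that the quartic sum is \<open>Q B = (\<Sum>j. \<langle>P\<^sub>j, B\<rangle>\<^sup>2)\<close>. Its trace on
  the symmetric matrices is \<open>6\<close> and the direction of the identity contributes \<open>2\<close>, so its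
  average over an orthonormal basis of the five-dimensional traceless part is \<open>4 / 5\<close>.
  If the infimum is \<open>4 / 5\<close>, every vector of an orthogonal traceless basis is a null vector of the
  positive semidefinite form \<open>Q - 4 / 5 \<parallel>\<cdot>\<parallel>\<^sup>2\<close>, hence lies in its radical, and
  \<open>Q B = 4 / 5 \<parallel>B\<parallel>\<^sup>2 + 2 / 5 (tr B)\<^sup>2\<close>. Polarising against the identity gives the tight frame
  condition. Inserting \<open>P\<^sub>i\<close> shows that the five numbers \<open>(d\<^sub>i \<cdot> d\<^sub>j)\<^sup>2\<close> have sum \<open>1\<close> and square sum
  \<open>1 / 5\<close>, so all equal \<open>1 / 5\<close>. Conversely, if the lines are equiangular, the Gram matrix
  \<open>4 / 5 I + 1 / 5 J\<close> of the \<open>P\<^sub>j\<close> is nonsingular, so they form a basis of the symmetric matrices, in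
  which the formula for \<open>Q\<close> can be read off.
\<close>

section \<open>Rank-one matrices and the quadratic form they define\<close>

lemma outer_square_nth: "outer_square u $ i $ j = u $ i * u $ j"
  by (simp add: outer_square_def matrix_matrix_mult_def columnvector_def rowvector_def)

lemma outer_square_inner: "outer_square u \<bullet> B = u \<bullet> (B *v u)"
  by (simp add: inner_vec_def matrix_vector_mult_def outer_square_nth sum_distrib_left mult_ac)

lemma outer_square_mult_vector: "outer_square u *v v = (u \<bullet> v) *\<^sub>R u"
  by (simp add: vec_eq_iff matrix_vector_mult_def outer_square_nth inner_vec_def
      sum_distrib_left mult_ac)

lemma outer_square_inner_outer_square: "outer_square u \<bullet> outer_square v = (u \<bullet> v)\<^sup>2"
  by (simp add: outer_square_inner outer_square_mult_vector inner_commute power2_eq_square)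

lemma trace_eq_inner: "trace B = mat 1 \<bullet> (B :: real^'n^'n)"
  by (simp add: trace_def inner_vec_def mat_def if_distrib[of "\<lambda>x. x * _"] cong: if_cong)

lemma trace_outer_square: "trace (outer_square u) = (norm u)\<^sup>2"
  by (simp add: trace_def outer_square_nth power2_norm_eq_inner inner_vec_def)

lemma subspace_Sym3: "subspace Sym3"
  by (auto simp: subspace_def Sym3_def transpose_def vec_eq_iff)

lemma outer_square_in_Sym3: "outer_square u \<in> Sym3"
  by (simp add: Sym3_def transpose_def vec_eq_iff outer_square_nth mult.commute)

lemma mat_in_Sym3: "mat k \<in> Sym3"
  by (simp add: Sym3_def)

lemma inner_mat_1_self: "(mat 1 :: real^3^3) \<bullet> mat 1 = 3"
  by (simp add: flip: trace_eq_inner) (simp add: trace_def mat_def)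

lemma quartic_sum_eq: "quartic_sum d B = (\<Sum>j\<in>UNIV. (outer_square (d j) \<bullet> B)\<^sup>2)"
  by (simp add: quartic_sum_def outer_square_inner)

text \<open>Each summand is the square of a functional linear in the matrix, so the form is
  quadratic. The middle sum is its polar form, which later yields information beyond single values
  of the form.\<close>

lemma quartic_sum_add_scaleR:
  "quartic_sum d (B + t *\<^sub>R C) = quartic_sum d B
    + 2 * t * (\<Sum>j\<in>UNIV. (outer_square (d j) \<bullet> B) * (outer_square (d j) \<bullet> C))
    + t\<^sup>2 * quartic_sum d C"
  by (simp add: quartic_sum_eq inner_add_right sum.distrib sum_distrib_left
      power2_eq_square algebra_simps)

section \<open>Coordinates on the symmetric matrices\<close>

definition sym_mat :: "real \<Rightarrow> real \<Rightarrow> real \<Rightarrow> real \<Rightarrow> real \<Rightarrow> real \<Rightarrow> real^3^3"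
  where "sym_mat a b c p q r = vector [vector [a, p, q], vector [p, b, r], vector [q, r, c]]"

lemma sym_mat_in_Sym3: "sym_mat a b c p q r \<in> Sym3"
  by (simp add: Sym3_def sym_mat_def transpose_def vec_eq_iff forall_3)

lemma Sym3_eq_sym_mat:
  assumes "B \<in> Sym3"
  shows "B = sym_mat (B$1$1) (B$2$2) (B$3$3) (B$1$2) (B$1$3) (B$2$3)"
proof -
  have "B $ i $ j = B $ j $ i" for i j
    using assms by (metis (mono_tags, lifting) Sym3_def mem_Collect_eq transpose_def vec_lambda_beta)
  then show ?thesis
    by (simp add: sym_mat_def vec_eq_iff forall_3)
qed

lemma inner_sym_mat:
  "sym_mat a b c p q r \<bullet> sym_mat a' b' c' p' q' r'
    = a * a' + b * b' + c * c' + 2 * (p * p' + q * q' + r * r')"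
  by (simp add: sym_mat_def inner_vec_def sum_3)

lemma outer_square_inner_sym_mat:
  "outer_square u \<bullet> sym_mat a b c p q r
    = a * (u$1)\<^sup>2 + b * (u$2)\<^sup>2 + c * (u$3)\<^sup>2
      + 2 * (p * (u$1 * u$2) + q * (u$1 * u$3) + r * (u$2 * u$3))"
  by (simp add: sym_mat_def inner_vec_def sum_3 outer_square_nth power2_eq_square)

text \<open>The six free entries give a spanning set. The bound lets six independent symmetric
  matrices be recognised as a basis.\<close>

lemma dim_Sym3: "dim Sym3 \<le> 6"
proof -
  let ?S = "{sym_mat 1 0 0 0 0 0, sym_mat 0 1 0 0 0 0, sym_mat 0 0 1 0 0 0,
             sym_mat 0 0 0 1 0 0, sym_mat 0 0 0 0 1 0, sym_mat 0 0 0 0 0 1}"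
  have "Sym3 \<subseteq> span ?S"
  proof
    fix B assume "B \<in> Sym3"
    then have "B = B$1$1 *\<^sub>R sym_mat 1 0 0 0 0 0 + B$2$2 *\<^sub>R sym_mat 0 1 0 0 0 0
        + B$3$3 *\<^sub>R sym_mat 0 0 1 0 0 0 + B$1$2 *\<^sub>R sym_mat 0 0 0 1 0 0
        + B$1$3 *\<^sub>R sym_mat 0 0 0 0 1 0 + B$2$3 *\<^sub>R sym_mat 0 0 0 0 0 1"
      by (subst Sym3_eq_sym_mat) (auto simp: sym_mat_def vec_eq_iff forall_3)
    moreover have "\<dots> \<in> span ?S"
      by (intro span_add span_scale span_base) auto
    ultimately show "B \<in> span ?S"
      by metis
  qed
  then have "dim Sym3 \<le> card ?S"
    by (intro dim_le_card) auto
  also have "\<dots> \<le> 6"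
    by (simp add: card_insert_if)
  finally show ?thesis .
qed

section \<open>The upper bound by averaging over the traceless part\<close>

lemma alpha_mult_le:
  assumes "B \<in> Sym3"
  shows "alpha d * (norm B)\<^sup>2 \<le> quartic_sum d B"
proof (cases "B = 0")
  case True
  then show ?thesis by (simp add: quartic_sum_eq)
next
  case False
  \<comment> \<open>Both sides are homogeneous of degree two, so \<open>B\<close> can be rescaled to
    the unit sphere, where the infimum is taken.\<close>
  let ?C = "(1 / norm B) *\<^sub>R B"
  have "alpha d \<le> quartic_sum d ?C"
    unfolding alpha_def
  proof (rule cINF_lower)
    show "bdd_below (quartic_sum d ` {B \<in> Sym3. norm B = 1})"
      by (rule bdd_belowI[of _ 0]) (auto simp: quartic_sum_def intro: sum_nonneg)
    show "?C \<in> {B \<in> Sym3. norm B = 1}"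
      using assms False by (simp add: subspace_scale[OF subspace_Sym3])
  qed
  also have "quartic_sum d ?C = quartic_sum d B / (norm B)\<^sup>2"
    by (simp add: quartic_sum_eq power_divide sum_divide_distrib)
  finally show ?thesis
    using False by (simp add: field_simps)
qed

text \<open>The five matrices are pairwise orthogonal but left unnormalised, which keeps square
  roots out; their squared norms are 2, 6, 2, 2, 2.\<close>

definition traceless_basis :: "(real^3^3) set"
  where "traceless_basis =
    {sym_mat 1 (-1) 0 0 0 0, sym_mat 1 1 (-2) 0 0 0,
     sym_mat 0 0 0 1 0 0, sym_mat 0 0 0 0 1 0, sym_mat 0 0 0 0 0 1}"

lemma traceless_basis_subset: "traceless_basis \<subseteq> Sym3"
  by (simp add: traceless_basis_def sym_mat_in_Sym3)

lemma traceless_in_span: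
  assumes "B \<in> Sym3" "trace B = 0"
  shows "B \<in> span traceless_basis"
proof -
  have B33: "B$3$3 = - B$1$1 - B$2$2"
    using assms(2) by (simp add: trace_def sum_3)
  have "B = ((B$1$1 - B$2$2) / 2) *\<^sub>R sym_mat 1 (-1) 0 0 0 0
      + ((B$1$1 + B$2$2) / 2) *\<^sub>R sym_mat 1 1 (-2) 0 0 0
      + B$1$2 *\<^sub>R sym_mat 0 0 0 1 0 0
      + B$1$3 *\<^sub>R sym_mat 0 0 0 0 1 0 + B$2$3 *\<^sub>R sym_mat 0 0 0 0 0 1"
    using B33 by (subst Sym3_eq_sym_mat[OF assms(1)])
      (auto simp: sym_mat_def vec_eq_iff forall_3 field_simps)
  moreover have "\<dots> \<in> span traceless_basis"
    unfolding traceless_basis_def by (intro span_add span_scale span_base) auto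
  ultimately show ?thesis
    by metis
qed

text \<open>The weights are the reciprocal squared norms, so the left side is the trace of the form
  on the traceless part. Each direction contributes the squared norm of the traceless part of its
  outer square, \<open>1 - 1 / 3 = 2 / 3\<close>, and there are six directions.\<close>

lemma sum_quartic_sum_traceless_basis:
  assumes "\<And>j. norm (d j) = 1"
  shows "quartic_sum d (sym_mat 1 (-1) 0 0 0 0) / 2 + quartic_sum d (sym_mat 1 1 (-2) 0 0 0) / 6
    + quartic_sum d (sym_mat 0 0 0 1 0 0) / 2 + quartic_sum d (sym_mat 0 0 0 0 1 0) / 2
    + quartic_sum d (sym_mat 0 0 0 0 0 1) / 2 = 4"
    (is "?L = 4")
proof -
  have pointwise: "(x - y)\<^sup>2 / 2 + (x + y - 2 * z)\<^sup>2 / 6 + 2 * (x * y) + 2 * (x * z) + 2 * (y * z)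
      = 2 / 3 * (x + y + z)\<^sup>2" for x y z :: real
    by (simp add: power2_eq_square field_simps)
  have nrm: "(d j $ 1)\<^sup>2 + (d j $ 2)\<^sup>2 + (d j $ 3)\<^sup>2 = 1" for j
    using assms[of j] by (simp add: norm_eq_1 inner_vec_def sum_3 power2_eq_square)
  have "?L = (\<Sum>j\<in>UNIV. ((d j $ 1)\<^sup>2 - (d j $ 2)\<^sup>2)\<^sup>2 / 2
      + ((d j $ 1)\<^sup>2 + (d j $ 2)\<^sup>2 - 2 * (d j $ 3)\<^sup>2)\<^sup>2 / 6 + 2 * ((d j $ 1)\<^sup>2 * (d j $ 2)\<^sup>2)
      + 2 * ((d j $ 1)\<^sup>2 * (d j $ 3)\<^sup>2) + 2 * ((d j $ 2)\<^sup>2 * (d j $ 3)\<^sup>2))"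
    by (simp add: quartic_sum_eq outer_square_inner_sym_mat sum.distrib sum_divide_distrib
        power_mult_distrib sum_distrib_left)
  also have "\<dots> = (\<Sum>j\<in>(UNIV::6 set). 2 / 3)"
    by (simp only: pointwise nrm) simp
  finally show ?thesis by simp
qed

lemma norm_traceless_basis:
  "(norm (sym_mat 1 (-1) 0 0 0 0))\<^sup>2 = 2" "(norm (sym_mat 1 1 (-2) 0 0 0))\<^sup>2 = 6"
  "(norm (sym_mat 0 0 0 1 0 0))\<^sup>2 = 2" "(norm (sym_mat 0 0 0 0 1 0))\<^sup>2 = 2"
  "(norm (sym_mat 0 0 0 0 0 1))\<^sup>2 = 2"
  by (simp_all add: power2_norm_eq_inner inner_sym_mat)

text \<open>Five normalised values, each at least \<open>alpha d\<close>, add up to 4. If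
  \<open>alpha d\<close> equals their mean \<open>4 / 5\<close>, none of them can exceed it.\<close>

lemma alpha_traceless_basis:
  assumes "\<And>j. norm (d j) = 1"
  shows "alpha d \<le> 4 / 5"
    and "alpha d = 4 / 5 \<Longrightarrow> E \<in> traceless_basis \<Longrightarrow> quartic_sum d E = 4 / 5 * (norm E)\<^sup>2"
proof -
  note le = alpha_mult_le[OF sym_mat_in_Sym3, of d]
  note bounds = le[of 1 "-1" 0 0 0 0] le[of 1 1 "-2" 0 0 0] le[of 0 0 0 1 0 0]
    le[of 0 0 0 0 1 0] le[of 0 0 0 0 0 1]
  note facts = bounds[unfolded norm_traceless_basis] sum_quartic_sum_traceless_basis[of d, OF assms]
  show "alpha d \<le> 4 / 5"
    using facts by linarith
  show "quartic_sum d E = 4 / 5 * (norm E)\<^sup>2" if "alpha d = 4 / 5" "E \<in> traceless_basis"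
    using that(2) facts unfolding that(1) traceless_basis_def
    by (elim insertE emptyE; simp only: norm_traceless_basis; linarith)
qed

section \<open>The form in the case of equality\<close>

lemma affine_nonneg_imp_slope_0:
  fixes a b :: real
  assumes "\<And>t. a + b * t \<ge> 0"
  shows "b = 0"
proof (rule ccontr)
  assume "b \<noteq> 0"
  then show False
    \<comment> \<open>At this point the affine function takes the value \<open>-1\<close>.\<close>
    using assms[of "- (a + 1) / b"] by simp
qed

text \<open>A null vector of a positive semidefinite form lies in its radical: along
  \<open>B + t *\<^sub>R E\<close> the quadratic term in \<open>t\<close> vanishes, so the
  nonnegative form is affine in \<open>t\<close> and its slope must be zero.\<close>

lemma quartic_sum_polar_null:
  assumes nonneg: "\<And>B. B \<in> Sym3 \<Longrightarrow> c * (norm B)\<^sup>2 \<le> quartic_sum d B"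
    and null: "quartic_sum d E = c * (norm E)\<^sup>2"
    and "B \<in> Sym3" "E \<in> Sym3"
  shows "(\<Sum>j\<in>UNIV. (outer_square (d j) \<bullet> B) * (outer_square (d j) \<bullet> E)) = c * (B \<bullet> E)"
proof -
  let ?b = "\<Sum>j\<in>UNIV. (outer_square (d j) \<bullet> B) * (outer_square (d j) \<bullet> E)"
  have "0 \<le> (quartic_sum d B - c * (norm B)\<^sup>2) + (2 * (?b - c * (B \<bullet> E))) * t" for t
  proof -
    have "B + t *\<^sub>R E \<in> Sym3"
      using assms(3,4) subspace_Sym3 by (simp add: subspace_add subspace_scale)
    moreover have "(norm (B + t *\<^sub>R E))\<^sup>2 = (norm B)\<^sup>2 + 2 * t * (B \<bullet> E) + t\<^sup>2 * (norm E)\<^sup>2"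
      unfolding power2_norm_eq_inner
      by (simp add: inner_add_left inner_add_right inner_commute[of E B] power2_eq_square
          algebra_simps)
    ultimately show ?thesis
      using nonneg[of "B + t *\<^sub>R E"] null by (simp add: quartic_sum_add_scaleR algebra_simps)
  qed
  from affine_nonneg_imp_slope_0[OF this] show ?thesis by simp
qed

lemma quartic_sum_if_alpha_eq:
  assumes unit: "\<And>j. norm (d j) = 1" and alpha: "alpha d = 4 / 5" and B: "B \<in> Sym3"
  shows "quartic_sum d B = 4 / 5 * (norm B)\<^sup>2 + 2 / 5 * (trace B)\<^sup>2"
proof -
  \<comment> \<open>\<open>N\<close> is the bilinear form of the quartic sum minus
    \<open>4 / 5\<close> times the squared norm.\<close>
  define N where "N C E = (\<Sum>j\<in>UNIV. (outer_square (d j) \<bullet> C) * (outer_square (d j) \<bullet> E)) - 4 / 5 * (C \<bullet> E)"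
    for C E
  have N_add: "N C (E + F) = N C E + N C F" and N_scale: "N C (t *\<^sub>R E) = t * N C E"
    and N_sym: "N C E = N E C" for C E F t
    by (simp_all add: N_def inner_add_right sum.distrib sum_distrib_left algebra_simps inner_commute[of C E])
  have null: "N C E = 0" if "C \<in> Sym3" "E \<in> traceless_basis" for C E
    using quartic_sum_polar_null[of "4/5" d E C] alpha_mult_le[of _ d] alpha
      alpha_traceless_basis(2)[of d, OF unit] that traceless_basis_subset
    by (auto simp: N_def)
  have null_span: "N C E = 0" if C: "C \<in> Sym3" and "E \<in> span traceless_basis" for C E
    using that(2)
  proof (rule span_induct)
    show "subspace {E. N C E = 0}"
      unfolding subspace_def using N_scale[of C 0 0] by (auto simp: N_add N_scale)
  qed (use null C in auto)
  define B0 where "B0 = B - (trace B / 3) *\<^sub>R mat 1"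
  have B0: "B0 \<in> Sym3"
    unfolding B0_def using B subspace_Sym3 mat_in_Sym3
    by (simp add: subspace_diff subspace_scale)
  have "trace B0 = 0"
    by (simp add: B0_def trace_eq_inner inner_diff_right inner_mat_1_self)
  then have B0_span: "B0 \<in> span traceless_basis"
    by (rule traceless_in_span[OF B0])
  have B_eq: "B = B0 + (trace B / 3) *\<^sub>R mat 1"
    by (simp add: B0_def)
  \<comment> \<open>Splitting off \<open>B0\<close> in one argument and then, by symmetry, in the
    other leaves only the value at the identity, \<open>6 - 12 / 5 = 18 / 5\<close>, weighted by
    \<open>(trace B / 3)\<^sup>2\<close>.\<close>
  have "N B B = N B B0 + trace B / 3 * N B (mat 1)"
    by (subst (2) B_eq) (simp add: N_add N_scale)
  also have "N B (mat 1) = N (mat 1) B"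
    by (rule N_sym)
  also have "\<dots> = N (mat 1) B0 + trace B / 3 * N (mat 1) (mat 1)"
    by (subst B_eq) (simp add: N_add N_scale)
  also have "N (mat 1) (mat 1) = 18 / 5"
    using unit by (simp add: N_def inner_mat_1_self inner_commute[of "outer_square _"]
        trace_outer_square flip: trace_eq_inner) (simp add: trace_def mat_def)
  finally have "N B B = 2 / 5 * (trace B)\<^sup>2"
    using null_span[OF B B0_span] null_span[OF mat_in_Sym3 B0_span] by (simp add: power2_eq_square)
  then show ?thesis
    by (simp add: N_def quartic_sum_eq power2_norm_eq_inner) (simp add: power2_eq_square)
qed

section \<open>Consequences of the explicit form\<close>

lemma alpha_eq_if_quartic_sum:
  assumes "\<And>B. B \<in> Sym3 \<Longrightarrow> quartic_sum d B = 4 / 5 * (norm B)\<^sup>2 + 2 / 5 * (trace B)\<^sup>2"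
    and unit: "\<And>j. norm (d j) = 1"
  shows "alpha d = 4 / 5"
proof (rule antisym)
  \<comment> \<open>The infimum is bounded below through its members, which requires the set to be
    nonempty; the trace term is nonnegative.\<close>
  have "\<exists>B \<in> Sym3. norm B = 1"
    by (rule bexI[of _ "sym_mat 1 0 0 0 0 0"])
      (simp_all add: norm_eq_1 inner_sym_mat sym_mat_in_Sym3)
  then show "4 / 5 \<le> alpha d"
    unfolding alpha_def by (intro cINF_greatest) (auto simp: assms(1))
qed (rule alpha_traceless_basis(1)[of d, OF unit])

text \<open>Comparing the explicit form at \<open>R\<close> and at \<open>R\<close> plus the
  identity isolates the polar value: the sum of the outer squares and
  \<open>2 *\<^sub>R mat 1\<close> have the same inner product with \<open>R\<close>. As
  \<open>R\<close> is their difference, it is orthogonal to itself.\<close>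

lemma frame_if_quartic_sum:
  assumes quartic: "\<And>B. B \<in> Sym3 \<Longrightarrow> quartic_sum d B = 4 / 5 * (norm B)\<^sup>2 + 2 / 5 * (trace B)\<^sup>2"
    and unit: "\<And>j. norm (d j) = 1"
  shows "(\<Sum>j\<in>UNIV. outer_square (d j)) = 2 *\<^sub>R mat 1"
proof -
  define R where "R = (\<Sum>j\<in>UNIV. outer_square (d j)) - 2 *\<^sub>R mat 1"
  have R: "R \<in> Sym3"
    unfolding R_def by (intro subspace_diff subspace_sum subspace_scale subspace_Sym3
        outer_square_in_Sym3 mat_in_Sym3)
  have I: "outer_square (d j) \<bullet> mat 1 = 1" for j
    using unit by (simp add: inner_commute[of "outer_square _"] trace_outer_square flip: trace_eq_inner)
  have "quartic_sum d (R + 1 *\<^sub>R mat 1) = quartic_sum d R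
      + 2 * ((\<Sum>j\<in>UNIV. outer_square (d j)) \<bullet> R) + 6"
    unfolding quartic_sum_add_scaleR by (simp add: I quartic_sum_eq[of d "mat 1"] inner_sum_left)
  moreover have "R + 1 *\<^sub>R mat 1 \<in> Sym3"
    using R mat_in_Sym3 subspace_Sym3 by (simp add: subspace_add)
  moreover have "(norm (R + 1 *\<^sub>R mat 1))\<^sup>2 = (norm R)\<^sup>2 + 2 * trace R + 3"
    by (simp add: power2_norm_eq_inner inner_add_left inner_add_right trace_eq_inner
        inner_mat_1_self inner_commute[of R "mat 1"])
  moreover have "trace (R + 1 *\<^sub>R mat 1) = trace R + 3"
    by (simp add: trace_eq_inner inner_add_right inner_mat_1_self)
  ultimately have "(\<Sum>j\<in>UNIV. outer_square (d j)) \<bullet> R = 2 * trace R"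
    by (simp add: quartic R power2_sum field_simps)
  then have "R \<bullet> R = 0"
    by (subst (1) R_def) (simp add: inner_diff_left trace_eq_inner)
  then show ?thesis
    by (simp add: R_def)
qed

text \<open>This is the equality case of Cauchy-Schwarz: the five values \<open>g k\<close> with
  \<open>k \<noteq> i\<close> have mean \<open>1 / 5\<close> and variance zero.\<close>

lemma equiangular_if_quartic_sum:
  fixes d :: "6 \<Rightarrow> real^3"
  assumes quartic: "\<And>B. B \<in> Sym3 \<Longrightarrow> quartic_sum d B = 4 / 5 * (norm B)\<^sup>2 + 2 / 5 * (trace B)\<^sup>2"
    and unit: "\<And>j. norm (d j) = 1" and "i \<noteq> j"
  shows "(d i \<bullet> d j)\<^sup>2 = 1 / 5"
proof -
  have ii: "d i \<bullet> d i = 1"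
    using unit[of i] by (simp add: norm_eq_1)
  define g where "g k = (d i \<bullet> d k)\<^sup>2" for k
  have sum1: "(\<Sum>k\<in>UNIV. g k) = 2"
  proof -
    have frame: "(\<Sum>k\<in>UNIV. outer_square (d k)) = 2 *\<^sub>R mat 1"
      using quartic unit by (rule frame_if_quartic_sum)
    have "(\<Sum>k\<in>UNIV. outer_square (d k)) \<bullet> outer_square (d i) = 2"
      unfolding frame by (simp add: trace_outer_square unit flip: trace_eq_inner)
    then show ?thesis
      by (simp add: inner_sum_left outer_square_inner_outer_square g_def inner_commute[of _ "d i"])
  qed
  \<comment> \<open>An outer square of a unit vector has norm and trace 1, so the explicit form
    gives \<open>4 / 5 + 2 / 5\<close>.\<close>
  have sum2: "(\<Sum>k\<in>UNIV. (g k)\<^sup>2) = 6 / 5"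
    using quartic[OF outer_square_in_Sym3[of "d i"]]
    by (simp add: quartic_sum_eq outer_square_inner_outer_square power2_norm_eq_inner
        trace_outer_square unit ii g_def inner_commute)
  have "g i = 1"
    by (simp add: g_def ii)
  then have "(\<Sum>k\<in>UNIV - {i}. g k) = 1" "(\<Sum>k\<in>UNIV - {i}. (g k)\<^sup>2) = 1 / 5"
    using sum1 sum2 by (simp_all add: sum.remove[of UNIV i])
  moreover have "card (UNIV - {i}) = 5"
    by simp
  \<comment> \<open>Expanding the squares gives \<open>1 / 5 - 2 / 5 + 5 / 25\<close>.\<close>
  ultimately have "(\<Sum>k\<in>UNIV - {i}. (g k - 1 / 5)\<^sup>2) = 0"
    by (simp add: power2_diff sum.distrib sum_subtractf power_divide
        flip: sum_distrib_left sum_distrib_right sum_divide_distrib)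
  then have "(g j - 1 / 5)\<^sup>2 = 0"
    using \<open>i \<noteq> j\<close> by (subst (asm) sum_nonneg_eq_0_iff) auto
  then show ?thesis
    by (simp add: g_def)
qed

section \<open>Equiangular lines determine the form\<close>

lemma quartic_sum_if_equiangular:
  fixes d :: "6 \<Rightarrow> real^3"
  assumes unit: "\<And>j. norm (d j) = 1"
    and equi: "\<And>i j. i \<noteq> j \<Longrightarrow> (d i \<bullet> d j)\<^sup>2 = 1 / 5"
    and B: "B \<in> Sym3"
  shows "quartic_sum d B = 4 / 5 * (norm B)\<^sup>2 + 2 / 5 * (trace B)\<^sup>2"
proof -
  define f :: "real^6 \<Rightarrow> real^3^3" where "f c = (\<Sum>j\<in>UNIV. c $ j *\<^sub>R outer_square (d j))" for c
  define s :: "real^6 \<Rightarrow> real" where "s c = (\<Sum>j\<in>UNIV. c $ j)" for c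
  have lin: "linear f"
    by (intro linearI) (simp_all add: f_def scaleR_add_left sum.distrib scaleR_sum_right)
  have gram: "(d i \<bullet> d j)\<^sup>2 = (if i = j then 4 / 5 else 0) + 1 / 5" for i j
    using unit[of i] equi[of i j] by (auto simp: norm_eq_1)
  have inner_f: "outer_square (d i) \<bullet> f c = 4 / 5 * c $ i + s c / 5" for i c
    by (simp add: f_def s_def inner_sum_right outer_square_inner_outer_square gram distrib_left
        sum.distrib if_distrib[of "\<lambda>x. _ * x"] sum_divide_distrib cong: if_cong)
  have sum_s: "(\<Sum>i\<in>UNIV. outer_square (d i) \<bullet> f c) = 2 * s c" for c
    unfolding inner_f by (simp add: sum.distrib s_def flip: sum_distrib_left sum_divide_distrib)
  \<comment> \<open>The Gram matrix \<open>4 / 5 I + 1 / 5 J\<close> is inverted in two stages: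
    summing its rows recovers \<open>s c\<close>, and each row then recovers its own
    coefficient.\<close>
  have "inj f"
    unfolding linear_injective_0[OF lin]
  proof (intro allI impI)
    fix c assume c: "f c = 0"
    then have "s c = 0"
      using sum_s[of c] by simp
    then show "c = 0"
      using inner_f[of _ c] c by (simp add: vec_eq_iff)
  qed
  \<comment> \<open>Counting dimensions makes \<open>f\<close> surjective onto \<open>Sym3\<close>,
    so every symmetric matrix has coefficients \<open>c\<close>.\<close>
  then have "dim (range f) = 6"
    by (simp add: dim_image_eq lin)
  moreover have "range f \<subseteq> Sym3"
    by (auto simp: f_def intro!: subspace_sum subspace_scale subspace_Sym3 outer_square_in_Sym3)
  moreover have "subspace (range f)"
    by (simp add: lin linear_subspace_image)
  ultimately have "range f = Sym3"
    using dim_Sym3 subspace_Sym3 by (intro subspace_dim_equal) auto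
  then obtain c where c: "B = f c"
    using B by auto
  have tr: "trace B = s c"
    using unit by (simp add: c f_def s_def trace_eq_inner inner_sum_right)
      (simp add: trace_outer_square flip: trace_eq_inner)
  have nrm: "(norm B)\<^sup>2 = 4 / 5 * (\<Sum>i\<in>UNIV. (c $ i)\<^sup>2) + (s c)\<^sup>2 / 5"
  proof -
    have "(norm B)\<^sup>2 = (\<Sum>i\<in>UNIV. c $ i * (outer_square (d i) \<bullet> B))"
      by (simp add: power2_norm_eq_inner) (subst (1) c, simp add: f_def inner_sum_left)
    also have "\<dots> = 4 / 5 * (\<Sum>i\<in>UNIV. (c $ i)\<^sup>2) + (\<Sum>i\<in>UNIV. c $ i) * s c / 5"
      unfolding c inner_f
      by (simp add: distrib_left sum.distrib sum_distrib_left sum_distrib_right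
          sum_divide_distrib power2_eq_square algebra_simps)
    finally show ?thesis
      by (simp add: power2_eq_square flip: s_def)
  qed
  have "quartic_sum d B = (\<Sum>i\<in>UNIV. 16 / 25 * (c $ i)\<^sup>2 + 8 / 25 * s c * c $ i + (s c)\<^sup>2 / 25)"
    unfolding quartic_sum_eq c inner_f by (rule sum.cong) (auto simp: power2_eq_square algebra_simps)
  also have "\<dots> = 16 / 25 * (\<Sum>i\<in>UNIV. (c $ i)\<^sup>2) + 8 / 25 * s c * s c + 6 * (s c)\<^sup>2 / 25"
    by (simp add: sum.distrib sum_distrib_left s_def)
  \<comment> \<open>Both sides equal \<open>16 / 25\<close> times the sum of the squared
    coefficients plus \<open>14 / 25\<close> times \<open>(s c)\<^sup>2\<close>.\<close>
  finally show ?thesis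
    unfolding nrm tr by (simp add: power2_eq_square field_simps)
qed

section \<open>Vertices and axes of the regular icosahedron\<close>

lemma extreme_points_of_convex_hull_sphere:
  fixes W :: "'a::euclidean_space set"
  assumes "W \<subseteq> sphere a R"
  shows "x extreme_point_of (convex hull W) \<longleftrightarrow> x \<in> W"
proof
  assume x: "x \<in> W"
  have "convex hull W \<subseteq> cball a R"
    using assms by (intro hull_minimal) auto
  \<comment> \<open>A point inside a segment is strictly closer to \<open>a\<close> than one of the
    endpoints, which is impossible for a point on the sphere when both endpoints lie in the
    ball.\<close>
  then have "x \<notin> open_segment u v" if "u \<in> convex hull W" "v \<in> convex hull W" for u v
    using that x assms dist_decreases_open_segment[of x u v a] by (fastforce simp: subset_iff)
  then show "x extreme_point_of (convex hull W)"
    using x by (auto simp: extreme_point_of_def hull_inc)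
qed (rule extreme_point_of_convex_hull)

lemma affine_hull_opposite:
  fixes v :: "'a::real_vector"
  shows "affine hull {v, - v} = range (\<lambda>c. c *\<^sub>R v)"
proof -
  have "affine hull {v, - v} = {(a - b) *\<^sub>R v |a b. a + b = 1}"
    by (simp add: affine_hull_2 scaleR_diff_left)
  moreover have "\<exists>a b. a + b = 1 \<and> c = a - b" for c :: real
    by (rule exI[of _ "(1 + c) / 2"], rule exI[of _ "(1 - c) / 2"]) (simp add: field_simps)
  ultimately show ?thesis
    by (auto simp: image_iff) metis
qed

lemma affine_hull_opposite_eq_iff:
  fixes v w :: "'a::real_normed_vector"
  assumes "norm v = norm w"
  shows "affine hull {v, - v} = affine hull {w, - w} \<longleftrightarrow> v = w \<or> v = - w"
proof
  assume eq: "affine hull {v, - v} = affine hull {w, - w}"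
  have "v \<in> affine hull {w, - w}"
    unfolding eq[symmetric] by (simp add: hull_inc)
  then obtain c where c: "v = c *\<^sub>R w"
    by (auto simp: affine_hull_opposite)
  then have "\<bar>c\<bar> = 1 \<or> w = 0"
    using assms by auto
  then show "v = w \<or> v = - w"
    using c by (auto simp: abs_if split: if_splits)
qed (auto simp: insert_commute)

lemma golden_power2: "golden\<^sup>2 = golden + 1"
  by (simp add: golden_def power2_eq_square field_simps)

lemma golden_gt_1: "golden > 1"
  by (simp add: golden_def)

text \<open>One vertex is chosen from each opposite pair, so that the axes are listed without
  repetition.\<close>

definition icosahedron_half :: "(real^3) set"
  where "icosahedron_half =
    {vector [0, 1, golden], vector [0, 1, - golden],
     vector [1, golden, 0], vector [1, - golden, 0],
     vector [golden, 0, 1], vector [- golden, 0, 1]}"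

lemma uminus_vector_3: "- (vector [a, b, c] :: real^3) = vector [- a, - b, - c]"
  by (simp add: vec_eq_iff forall_3)

lemma vector_3_eq_iff: "(vector [a, b, c] :: real^3) = vector [a', b', c'] \<longleftrightarrow> a = a' \<and> b = b' \<and> c = c'"
  by (simp add: vec_eq_iff forall_3)

lemma inner_vector_3:
  "(vector [a, b, c] :: real^3) \<bullet> vector [a', b', c'] = a * a' + b * b' + c * c'"
  by (simp add: inner_vec_def sum_3)

lemma std_icosahedron_vertices_eq:
  "std_icosahedron_vertices = icosahedron_half \<union> uminus ` icosahedron_half"
  unfolding std_icosahedron_vertices_def icosahedron_half_def
  by (simp add: uminus_vector_3 insert_commute)

lemma card_icosahedron_half: "card icosahedron_half = 6"
  using golden_gt_1 by (simp add: icosahedron_half_def vector_3_eq_iff)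

lemma icosahedron_half_no_opposite: "v \<in> icosahedron_half \<Longrightarrow> - v \<notin> icosahedron_half"
  using golden_gt_1 by (auto simp: icosahedron_half_def vector_3_eq_iff uminus_vector_3)

lemma icosahedron_half_inner_self: "v \<in> icosahedron_half \<Longrightarrow> v \<bullet> v = golden + 2"
  using golden_power2 by (auto simp: icosahedron_half_def inner_vector_3 power2_eq_square)

text \<open>Every such inner product is \<open>golden\<close> or
  \<open>1 - golden\<^sup>2 = - golden\<close>, up to sign.\<close>

lemma icosahedron_half_inner:
  assumes "v \<in> icosahedron_half" "w \<in> icosahedron_half" "v \<noteq> w"
  shows "(v \<bullet> w)\<^sup>2 = golden\<^sup>2"
proof -
  have gg: "golden * golden = golden + 1"
    using golden_power2 by (simp add: power2_eq_square)
  show ?thesis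
    using assms unfolding icosahedron_half_def
    by (elim insertE emptyE) (simp_all add: inner_vector_3 gg)
qed

text \<open>A similarity fixing the origin scales all inner products by \<open>r\<^sup>2\<close>, so
  lengths and angles can be read off the standard model. \<open>U\<close> holds one vertex per axis
  and \<open>R\<close> is the common squared length.\<close>

lemma vertex_axes_regular_icosahedron:
  assumes "regular_icosahedron 0 P"
  obtains U :: "(real^3) set" and R :: real
  where "R > 0" "card U = 6" "inj_on (\<lambda>v. affine hull {v, - v}) U"
    "vertex_axes P = (\<lambda>v. affine hull {v, - v}) ` U"
    "\<And>v. v \<in> U \<Longrightarrow> v \<bullet> v = R"
    "\<And>v w. v \<in> U \<Longrightarrow> w \<in> U \<Longrightarrow> v \<noteq> w \<Longrightarrow> (v \<bullet> w)\<^sup>2 = R\<^sup>2 / 5"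
proof -
  obtain r f where r: "r > 0" and f: "orthogonal_transformation f"
    and P: "P = (\<lambda>x. r *\<^sub>R f x) ` (convex hull std_icosahedron_vertices)"
    using assms by (auto simp: regular_icosahedron_def)
  define g where "g x = r *\<^sub>R f x" for x
  have lin: "linear g"
    unfolding g_def by (intro linear_compose_scale_right orthogonal_transformation_linear f)
  have inner_g: "g x \<bullet> g y = r\<^sup>2 * (x \<bullet> y)" for x y
    using f by (simp add: g_def orthogonal_transformation_def power2_eq_square)
  have inj: "inj g"
    using r orthogonal_transformation_inj[OF f] by (simp add: g_def inj_def)
  have g_minus: "g (- x) = - g x" for x
    by (rule linear_neg[OF lin])
  define U where "U = g ` icosahedron_half"
  define R where "R = r\<^sup>2 * (golden + 2)"
  have self: "v \<bullet> v = R" if "v \<in> U" for v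
    using that by (auto simp: U_def inner_g icosahedron_half_inner_self R_def)
  then have nrm: "norm v = sqrt R" if "v \<in> U" for v
    using that by (simp add: norm_eq_sqrt_inner)
  have "P = convex hull (U \<union> uminus ` U)"
    unfolding P g_def[symmetric] convex_hull_linear_image[OF lin]
      std_icosahedron_vertices_eq U_def image_Un image_image g_minus ..
  moreover have "U \<union> uminus ` U \<subseteq> sphere 0 (sqrt R)"
    using nrm by auto
  ultimately have ext: "v extreme_point_of P \<longleftrightarrow> v \<in> U \<union> uminus ` U" for v
    using extreme_points_of_convex_hull_sphere by metis
  have axes: "vertex_axes P = (\<lambda>v. affine hull {v, - v}) ` U"
    unfolding vertex_axes_def ext by (auto simp: insert_commute image_iff)
  have "inj_on (\<lambda>v. affine hull {v, - v}) U"
  proof (rule inj_onI)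
    fix v w assume vw: "v \<in> U" "w \<in> U" "affine hull {v, - v} = affine hull {w, - w}"
    then have "v = w \<or> v = - w"
      using nrm by (simp add: affine_hull_opposite_eq_iff)
    moreover have "v \<noteq> - w"
      using vw(1,2) icosahedron_half_no_opposite injD[OF inj]
      by (auto simp: U_def simp flip: g_minus) metis
    ultimately show "v = w"
      by blast
  qed
  moreover have "card U = 6"
    by (simp add: U_def card_image inj_on_subset[OF inj] card_icosahedron_half)
  moreover have "(v \<bullet> w)\<^sup>2 = R\<^sup>2 / 5" if "v \<in> U" "w \<in> U" "v \<noteq> w" for v w
  proof -
    obtain x y where "v = g x" "w = g y" "x \<in> icosahedron_half" "y \<in> icosahedron_half" "x \<noteq> y"
      using \<open>v \<in> U\<close> \<open>w \<in> U\<close> \<open>v \<noteq> w\<close> by (auto simp: U_def)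
    \<comment> \<open>This identity turns the squared cosine
      \<open>golden\<^sup>2 / (golden + 2)\<^sup>2\<close> into \<open>1 / 5\<close>.\<close>
    moreover have "(golden + 2)\<^sup>2 = 5 * golden\<^sup>2"
      using golden_power2 by (simp add: power2_eq_square algebra_simps)
    ultimately show ?thesis
      by (simp add: inner_g power_mult_distrib icosahedron_half_inner R_def)
  qed
  moreover have "R > 0"
    using r golden_gt_1 by (simp add: R_def)
  ultimately show ?thesis
    using that axes self by blast
qed

lemma equiangular_icosahedron:
  fixes d :: "6 \<Rightarrow> real^3"
  assumes "regular_icosahedron 0 P" and bij: "bij_betw A UNIV (vertex_axes P)"
    and d: "\<And>j. norm (d j) = 1" "\<And>j. d j \<in> A j" and "i \<noteq> j"
  shows "(d i \<bullet> d j)\<^sup>2 = 1 / 5"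
proof -
  obtain U R where "card U = 6" "inj_on (\<lambda>v. affine hull {v, - v}) U" and U: "R > 0"
    "vertex_axes P = (\<lambda>v. affine hull {v, - v}) ` U"
    "\<And>v. v \<in> U \<Longrightarrow> v \<bullet> v = R"
    "\<And>v w. v \<in> U \<Longrightarrow> w \<in> U \<Longrightarrow> v \<noteq> w \<Longrightarrow> (v \<bullet> w)\<^sup>2 = R\<^sup>2 / 5"
    by (rule vertex_axes_regular_icosahedron[OF assms(1)]) (rule that)
  \<comment> \<open>A unit vector on an axis is determined up to sign; recording only
    \<open>c\<^sup>2\<close> removes the sign, which the squared inner product does not see.\<close>
  have "\<exists>v c. v \<in> U \<and> A k = affine hull {v, - v} \<and> d k = c *\<^sub>R v \<and> c\<^sup>2 = 1 / R" for k
  proof -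
    have "A k \<in> vertex_axes P"
      using bij bij_betwE by blast
    then obtain v where v: "v \<in> U" "A k = affine hull {v, - v}"
      using U(2) by auto
    then obtain c where c: "d k = c *\<^sub>R v"
      using d(2)[of k] by (auto simp: affine_hull_opposite)
    have "c\<^sup>2 * R = 1"
      using d(1)[of k] U(3)[OF v(1)] by (simp add: norm_eq_1) (simp add: c power2_eq_square)
    then show ?thesis
      using v c U(1) by (auto simp: field_simps)
  qed
  then obtain v c where v: "\<And>k. v k \<in> U" "\<And>k. A k = affine hull {v k, - v k}"
    and c: "\<And>k. d k = c k *\<^sub>R v k" "\<And>k. (c k)\<^sup>2 = 1 / R"
    by metis
  have "A i \<noteq> A j"
    using bij \<open>i \<noteq> j\<close> by (auto simp: bij_betw_def inj_def)
  then have "v i \<noteq> v j"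
    using v(2) by metis
  then have "(v i \<bullet> v j)\<^sup>2 = R\<^sup>2 / 5"
    using U(4) v(1) by blast
  moreover have "(d i \<bullet> d j)\<^sup>2 = (c i)\<^sup>2 * (c j)\<^sup>2 * (v i \<bullet> v j)\<^sup>2"
    unfolding c(1) by (simp add: power_mult_distrib)
  ultimately show ?thesis
    using U(1) by (simp only: c(2)) (simp add: power2_eq_square)
qed

theorem theoremC:
  "(\<forall>d :: 6 \<Rightarrow> real^3. (\<forall>j. norm (d j) = 1) \<longrightarrow>
      alpha d \<le> 4 / 5 \<and>
      (alpha d = 4 / 5 \<longleftrightarrow>
        (\<Sum>j\<in>UNIV. outer_square (d j)) = 2 *\<^sub>R mat 1 \<and>
        (\<forall>i j. i \<noteq> j \<longrightarrow> \<bar>d i \<bullet> d j\<bar>\<^sup>2 = 1 / 5)) \<and>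
      (alpha d = 4 / 5 \<longrightarrow>
        (\<forall>B\<in>Sym3. \<forall>B0. B = B0 + (trace B / 3) *\<^sub>R mat 1 \<and> trace B0 = 0 \<longrightarrow>
          quartic_sum d B = 4 / 5 * (norm B0)\<^sup>2 + 2 / 3 * (trace B)\<^sup>2)))
   \<and>
   (\<forall>P. regular_icosahedron 0 P \<longrightarrow>
      card (vertex_axes P) = 6 \<and>
      (\<forall>(A :: 6 \<Rightarrow> (real^3) set) (d :: 6 \<Rightarrow> real^3).
        bij_betw A UNIV (vertex_axes P) \<and> (\<forall>j. norm (d j) = 1 \<and> d j \<in> A j) \<longrightarrow>
        alpha d = 4 / 5))"
proof (intro conjI allI impI ballI)
  fix d :: "6 \<Rightarrow> real^3"
  assume "\<forall>j. norm (d j) = 1"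
  then have unit: "\<And>j. norm (d j) = 1"
    by blast
  note quartic = quartic_sum_if_alpha_eq[of d, OF unit]
  show "alpha d \<le> 4 / 5"
    by (rule alpha_traceless_basis(1)[of d, OF unit])
  show "alpha d = 4 / 5 \<longleftrightarrow>
      (\<Sum>j\<in>UNIV. outer_square (d j)) = 2 *\<^sub>R mat 1 \<and>
      (\<forall>i j. i \<noteq> j \<longrightarrow> \<bar>d i \<bullet> d j\<bar>\<^sup>2 = 1 / 5)"
  proof (intro iffI conjI allI impI)
    assume alpha: "alpha d = 4 / 5"
    show "(\<Sum>j\<in>UNIV. outer_square (d j)) = 2 *\<^sub>R mat 1"
      using quartic[OF alpha] unit by (rule frame_if_quartic_sum)
    show "\<bar>d i \<bullet> d j\<bar>\<^sup>2 = 1 / 5" if "i \<noteq> j" for i j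
      using equiangular_if_quartic_sum[of d i j] quartic[OF alpha] unit that by simp
  next
    assume "(\<Sum>j\<in>UNIV. outer_square (d j)) = 2 *\<^sub>R mat 1 \<and>
      (\<forall>i j. i \<noteq> j \<longrightarrow> \<bar>d i \<bullet> d j\<bar>\<^sup>2 = 1 / 5)"
    then show "alpha d = 4 / 5"
      using unit by (intro alpha_eq_if_quartic_sum quartic_sum_if_equiangular) auto
  qed
  fix B B0 :: "real^3^3"
  assume alpha: "alpha d = 4 / 5" and B: "B \<in> Sym3"
    and B0: "B = B0 + (trace B / 3) *\<^sub>R mat 1 \<and> trace B0 = 0"
  \<comment> \<open>Orthogonality to the identity allows Pythagoras; the trace coefficient becomes
    \<open>4 / 5 * (1 / 3) + 2 / 5 = 2 / 3\<close>.\<close>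
  have "B0 \<bullet> mat 1 = 0"
    using B0 by (simp add: trace_eq_inner inner_commute)
  then have "(norm B)\<^sup>2 = (norm B0)\<^sup>2 + (norm ((trace B / 3) *\<^sub>R (mat 1 :: real^3^3)))\<^sup>2"
    using B0 norm_add_Pythagorean[of B0 "(trace B / 3) *\<^sub>R mat 1"] by (simp add: orthogonal_def)
  also have "(norm ((trace B / 3) *\<^sub>R (mat 1 :: real^3^3)))\<^sup>2 = (trace B)\<^sup>2 / 3"
    unfolding power2_norm_eq_inner by (simp add: inner_mat_1_self power2_eq_square)
  finally show "quartic_sum d B = 4 / 5 * (norm B0)\<^sup>2 + 2 / 3 * (trace B)\<^sup>2"
    by (simp add: quartic[OF alpha B] field_simps)
next
  fix P :: "(real^3) set"
  assume P: "regular_icosahedron 0 P"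
  show "card (vertex_axes P) = 6"
    by (rule vertex_axes_regular_icosahedron[OF P]) (simp add: card_image)
  fix A :: "6 \<Rightarrow> (real^3) set" and d :: "6 \<Rightarrow> real^3"
  assume "bij_betw A UNIV (vertex_axes P) \<and> (\<forall>j. norm (d j) = 1 \<and> d j \<in> A j)"
  then have unit: "\<And>j. norm (d j) = 1" and "\<And>i j. i \<noteq> j \<Longrightarrow> (d i \<bullet> d j)\<^sup>2 = 1 / 5"
    using equiangular_icosahedron[OF P] by blast+
  then show "alpha d = 4 / 5"
    by (intro alpha_eq_if_quartic_sum quartic_sum_if_equiangular)
qed

end
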